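(* Let $n\ge 2$ and $B=M_n(\mathbb{C})$. A marginal tracial state $\phi$ on $B\otimes B$ is a pure state if and only if there are orthonormal bases $\{f_i:1\le i\le n\}$ and $\{g_i:1\le i\le n\}$ of $\mathbb{C}^n$ such that $\phi(A)=\langle A\xi,\xi\rangle$ for all $A\in B\otimes B$, where $\xi=\sum_{i=1}^n \frac{f_i\otimes g_i}{\sqrt{n}}\in\mathbb{C}^n\otimes\mathbb{C}^n$.
   Context: $B\otimes B$ is identified with the full algebra of $n^2\times n^2$ matrices acting on $\mathbb{C}^n\otimes\mathbb{C}^n$. A state on $B\otimes B$ is a positive linear functional $\phi$ with $\phi(I)=1$; it is pure if it is an extreme point of the convex set of all states on $B\otimes B$. Let $\tau_B=\frac1n\mathrm{Tr}$ be the unique tracial state (normalized trace) on $B$. A state $\phi$ on $B\otimes B$ is called a marginal tracial state if $\phi(x\otimes I)=\tau_B(x)$ and $\phi(I\otimes x)=\tau_B(x)$ for all $x\in B$. *)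

theory Defs
  imports "HOL-Analysis.Analysis" "HOL-Library.Function_Algebras"
begin

text \<open>
  \<open>\<complex>\<^sup>n\<close> is \<open>complex ^ 'n\<close> with \<open>n = CARD('n)\<close>, and \<open>M\<^sub>n(\<complex>)\<close> is \<open>complex ^ 'n ^ 'n\<close>. The tensor
  product \<open>\<complex>\<^sup>n \<otimes> \<complex>\<^sup>m\<close> is \<open>complex ^ ('n \<times> 'm)\<close>, and correspondingly \<open>M\<^sub>n(\<complex>) \<otimes> M\<^sub>m(\<complex>)\<close> is the full
  algebra of matrices indexed by \<open>'n \<times> 'm\<close>.
\<close>

text \<open>
  HOL-Analysis provides no vector space structure on functions; the pointwise one is needed for
  the library notion \<^const>\<open>extreme_point_of\<close> to apply to sets of functionals.
\<close>

instantiation "fun" :: (type, real_vector) real_vector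
begin

definition scaleR_fun :: "real \<Rightarrow> ('a \<Rightarrow> 'b) \<Rightarrow> 'a \<Rightarrow> 'b"
  where "scaleR_fun r f = (\<lambda>x. r *\<^sub>R f x)"

instance
  by standard (auto simp: scaleR_fun_def plus_fun_def algebra_simps)

end


section \<open>Vectors\<close>

text \<open>
  The inner product from \<^class>\<open>real_inner\<close> on \<open>complex ^ 'n\<close> is only the real part of the
  Hermitian one. The Hermitian one is linear in the first argument.
\<close>

definition cinner :: "complex ^ 'n \<Rightarrow> complex ^ 'n \<Rightarrow> complex"
  where "cinner x y = (\<Sum>i\<in>UNIV. x $ i * cnj (y $ i))"

definition orthonormal_basis :: "('n \<Rightarrow> complex ^ 'n) \<Rightarrow> bool"
  where "orthonormal_basis f \<longleftrightarrow>
    (\<forall>i j. cinner (f i) (f j) = (if i = j then 1 else 0)) \<and> vec.span (range f) = UNIV"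

definition tensor_vec :: "complex ^ 'n \<Rightarrow> complex ^ 'm \<Rightarrow> complex ^ ('n \<times> 'm)"
  where "tensor_vec x y = (\<chi> p. x $ fst p * y $ snd p)"


section \<open>Matrices\<close>

definition tensor_mat ::
    "complex ^ 'n ^ 'n \<Rightarrow> complex ^ 'm ^ 'm \<Rightarrow> complex ^ ('n \<times> 'm) ^ ('n \<times> 'm)"
  where "tensor_mat A B = (\<chi> p q. A $ fst p $ fst q * B $ snd p $ snd q)"

lemma tensor_mat_tensor_vec:
  "tensor_mat A B *v tensor_vec x y = tensor_vec (A *v x) (B *v y)"
  by (simp add: vec_eq_iff matrix_vector_mult_def tensor_mat_def tensor_vec_def sum_product
      sum.cartesian_product case_prod_unfold mult_ac)

definition adjoint_mat :: "complex ^ 'm ^ 'm \<Rightarrow> complex ^ 'm ^ 'm"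
  where "adjoint_mat A = map_matrix cnj (transpose A)"

definition scale_mat :: "complex \<Rightarrow> complex ^ 'm ^ 'm \<Rightarrow> complex ^ 'm ^ 'm"
  where "scale_mat c A = map_matrix ((*) c) A"

lemma vector_space_scale_mat: "vector_space scale_mat"
  by standard (simp_all add: scale_mat_def vec_eq_iff algebra_simps)

definition normalized_trace :: "complex ^ 'n ^ 'n \<Rightarrow> complex"
  where "normalized_trace A = trace A / of_nat CARD('n)"


section \<open>States\<close>

definition is_state :: "(complex ^ 'm ^ 'm \<Rightarrow> complex) \<Rightarrow> bool"
  where "is_state \<phi> \<longleftrightarrow>
    Vector_Spaces.linear scale_mat (*) \<phi> \<and>
    (\<forall>A. \<phi> (adjoint_mat A ** A) \<in> \<real>\<^sub>\<ge>\<^sub>0) \<and>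
    \<phi> (mat 1) = 1"

definition is_pure_state :: "(complex ^ 'm ^ 'm \<Rightarrow> complex) \<Rightarrow> bool"
  where "is_pure_state \<phi> \<longleftrightarrow> \<phi> extreme_point_of {\<psi>. is_state \<psi>}"

definition marginal_tracial_state ::
    "(complex ^ ('n::finite \<times> 'n) ^ ('n \<times> 'n) \<Rightarrow> complex) \<Rightarrow> bool"
  where "marginal_tracial_state \<phi> \<longleftrightarrow>
    is_state \<phi> \<and>
    (\<forall>x. \<phi> (tensor_mat x (mat 1)) = normalized_trace x) \<and>
    (\<forall>x. \<phi> (tensor_mat (mat 1) x) = normalized_trace x)"

end

theory Submission
  imports Defs
begin

text \<open>
  A pure state on a full matrix algebra is a vector state, and a vector state has tracial left
  marginal exactly when the coefficient matrix of its vector is \<open>1/\<surd>n\<close> times a unitary. The rows of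
  that unitary, paired with the standard basis, are the required orthonormal bases.

  Everything about states rests on the Cauchy-Schwarz inequality for the positive semidefinite form
  \<open>(A, B) \<mapsto> \<phi> (A\<^sup>* B)\<close> (\<open>Cauchy_Schwarz_functional\<close>).

  Pure states are vector states (\<open>pure_state_is_vector_state\<close>): fix a basis vector \<open>e\<close> with \<open>c = \<phi> (e e\<^sup>*) > 0\<close> and let \<open>v\<close> represent the functional
  \<open>y \<mapsto> \<phi> (e y\<^sup>*)\<close>. Cauchy-Schwarz applied to \<open>(A v) e\<^sup>*\<close> and \<open>A\<close> yields
  \<open>\<parallel>A v\<parallel>\<^sup>2 \<le> c \<phi> (A\<^sup>* A)\<close> (\<open>state_dominates_vector_functional\<close>). So \<open>\<phi>\<close> dominates a positive multiple of
  the vector state of \<open>v / \<parallel>v\<parallel>\<close>, and extremality forces \<open>\<phi>\<close> to be that vector state.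

  Vector states are pure (\<open>vector_state_pure\<close>): let \<open>x\<close> be a unit vector. If the vector state of \<open>x\<close>
  is a proper convex combination of two states, both vanish on the projection \<open>1 - x x\<^sup>*\<close>. By
  Cauchy-Schwarz a state that vanishes there depends only on the compression of its argument to the
  line of \<open>x\<close>, so it is the vector state itself. The vector \<open>\<xi>\<close> of the theorem is a unit vector because
  \<open>\<parallel>\<xi>\<parallel>\<^sup>2 = \<phi> 1 = 1\<close>.

  The marginal condition (\<open>tracial_vector_maximally_entangled\<close>): evaluating at \<open>E\<^sub>j\<^sub>i \<otimes> 1\<close> turns the
  trace identity into the orthogonality relations between the rows of the coefficient matrix of \<open>x\<close>.
\<close>

section \<open>The Hermitian inner product and rank-one matrices\<close>

text \<open>The matrix \<open>x y\<^sup>*\<close> of the operator \<open>z \<mapsto> \<langle>z, y\<rangle> x\<close>.\<close>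

definition outer :: "complex ^ 'm \<Rightarrow> complex ^ 'm \<Rightarrow> complex ^ 'm ^ 'm"
  where "outer x y = (\<chi> p q. x $ p * cnj (y $ q))"

lemma cinner_self: "cinner x x = of_real ((norm x)\<^sup>2)"
proof -
  have "(norm x)\<^sup>2 = (\<Sum>i\<in>UNIV. (norm (x $ i))\<^sup>2)"
    by (simp add: norm_vec_def L2_set_def sum_nonneg)
  then show ?thesis
    by (simp add: cinner_def complex_norm_square[symmetric])
qed

lemma cinner_add_left: "cinner (x + y) z = cinner x z + cinner y z"
  by (simp add: cinner_def sum.distrib algebra_simps)

lemma cinner_scale_left: "cinner (c *s x) y = c * cinner x y"
  by (simp add: cinner_def sum_distrib_left mult.assoc)

lemma cinner_scale_right: "cinner x (c *s y) = cnj c * cinner x y"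
  by (simp add: cinner_def sum_distrib_left algebra_simps)

lemma cinner_adjoint: "cinner (A *v x) y = cinner x (adjoint_mat A *v y)"
proof -
  have "cinner (A *v x) y = (\<Sum>i\<in>UNIV. \<Sum>j\<in>UNIV. A $ i $ j * x $ j * cnj (y $ i))"
    by (simp add: cinner_def matrix_vector_mult_def sum_distrib_right)
  also have "\<dots> = (\<Sum>j\<in>UNIV. \<Sum>i\<in>UNIV. A $ i $ j * x $ j * cnj (y $ i))"
    by (rule sum.swap)
  also have "\<dots> = cinner x (adjoint_mat A *v y)"
    by (simp add: cinner_def matrix_vector_mult_def adjoint_mat_def transpose_def
        sum_distrib_left mult_ac)
  finally show ?thesis .
qed

lemma adjoint_adjoint [simp]: "adjoint_mat (adjoint_mat A) = A"
  by (simp add: vec_eq_iff adjoint_mat_def transpose_def)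

lemma adjoint_add: "adjoint_mat (A + B) = adjoint_mat A + adjoint_mat B"
  by (simp add: vec_eq_iff adjoint_mat_def transpose_def)

lemma adjoint_scale: "adjoint_mat (scale_mat c A) = scale_mat (cnj c) (adjoint_mat A)"
  by (simp add: vec_eq_iff adjoint_mat_def transpose_def scale_mat_def)

lemma adjoint_one [simp]: "adjoint_mat (mat 1) = mat 1"
  by (auto simp: vec_eq_iff adjoint_mat_def transpose_def mat_def)

lemma adjoint_diff: "adjoint_mat (A - B) = adjoint_mat A - adjoint_mat B"
  by (simp add: vec_eq_iff adjoint_mat_def transpose_def)

lemma adjoint_outer: "adjoint_mat (outer x y) = outer y x"
  by (simp add: vec_eq_iff adjoint_mat_def transpose_def outer_def)

lemma outer_mult: "outer x y ** A = outer x (adjoint_mat A *v y)"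
  by (simp add: vec_eq_iff matrix_matrix_mult_def matrix_vector_mult_def outer_def
      adjoint_mat_def transpose_def sum_distrib_left mult_ac)

lemma mult_outer: "A ** outer x y = outer (A *v x) y"
  by (simp add: vec_eq_iff matrix_matrix_mult_def matrix_vector_mult_def outer_def
      sum_distrib_right mult.assoc)

lemma outer_vec: "outer x y *v z = cinner z y *s x"
  by (simp add: vec_eq_iff matrix_vector_mult_def outer_def cinner_def
      sum_distrib_left sum_distrib_right mult_ac)

lemma outer_scale_left: "outer (c *s x) y = scale_mat c (outer x y)"
  by (simp add: vec_eq_iff outer_def scale_mat_def)

lemma outer_expand: "outer x y = (\<Sum>q\<in>UNIV. scale_mat (cnj (y $ q)) (outer x (axis q 1)))"
  by (simp add: vec_eq_iff outer_def scale_mat_def axis_def if_distrib[of "\<lambda>z. _ * z"]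
      if_distrib[of cnj] cong: if_cong)

lemma mat_one_expand: "mat 1 = (\<Sum>p\<in>UNIV. outer (axis p 1) (axis p 1))"
  by (simp add: vec_eq_iff outer_def mat_def axis_def if_distrib[of "\<lambda>z. _ * z"]
      if_distrib[of cnj] if_distrib[of "\<lambda>f. f _"] cong: if_cong)

lemma mult_diff_left: "(A - B) ** C = A ** C - B ** C" for A B C :: "complex ^ 'm ^ 'm"
  by (simp add: vec_eq_iff matrix_matrix_mult_def sum_subtractf left_diff_distrib)

lemma mult_diff_right: "C ** (A - B) = C ** A - C ** B" for A B C :: "complex ^ 'm ^ 'm"
  by (simp add: vec_eq_iff matrix_matrix_mult_def sum_subtractf right_diff_distrib)

lemma mult_add_left: "(A + B) ** C = A ** C + B ** C" for A B C :: "complex ^ 'm ^ 'm"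
  by (simp add: vec_eq_iff matrix_matrix_mult_def sum.distrib distrib_right)

lemma scale_mat_mult_left: "scale_mat c A ** B = scale_mat c (A ** B)"
  by (simp add: vec_eq_iff matrix_matrix_mult_def scale_mat_def sum_distrib_left mult_ac)

lemma scale_mat_mult_right: "A ** scale_mat c B = scale_mat c (A ** B)"
  by (simp add: vec_eq_iff matrix_matrix_mult_def scale_mat_def sum_distrib_left mult_ac)

lemma scale_mat_vec: "scale_mat c A *v x = c *s (A *v x)"
  by (simp add: vec_eq_iff matrix_vector_mult_def scale_mat_def sum_distrib_left mult_ac)

text \<open>
  The form \<open>P\<^sup>* P = P\<close> makes the complement of the line of \<open>x\<close> visible to positivity and to
  Cauchy-Schwarz, which speak of elements \<open>A\<^sup>* A\<close> only.
\<close>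

lemma complement_projection:
  assumes "cinner x x = 1"
  shows "adjoint_mat (mat 1 - outer x x) = mat 1 - outer x x"
    and "adjoint_mat (mat 1 - outer x x) ** (mat 1 - outer x x) = mat 1 - outer x x"
proof -
  show adj: "adjoint_mat (mat 1 - outer x x) = mat 1 - outer x x"
    by (simp add: adjoint_diff adjoint_outer)
  have "outer x x ** outer x x = outer x x"
    by (simp only: mult_outer outer_vec assms) (simp add: vec_eq_iff outer_def)
  then show "adjoint_mat (mat 1 - outer x x) ** (mat 1 - outer x x) = mat 1 - outer x x"
    by (simp only: adj) (simp add: mult_diff_right mult_diff_left)
qed

section \<open>Positive functionals\<close>

lemma linear_functional_iff:
  "Vector_Spaces.linear scale_mat (*) \<phi> \<longleftrightarrow>
    (\<forall>A B. \<phi> (A + B) = \<phi> A + \<phi> B) \<and> (\<forall>c A. \<phi> (scale_mat c A) = c * \<phi> A)"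
proof -
  have "vector_space ((*) :: complex \<Rightarrow> complex \<Rightarrow> complex)"
    by standard (simp_all add: algebra_simps)
  then show ?thesis
    using vector_space_scale_mat by (auto simp: Vector_Spaces.linear_iff)
qed

lemma linear_functional_sum:
  assumes "Vector_Spaces.linear scale_mat (*) \<phi>"
  shows "\<phi> (sum h S) = (\<Sum>i\<in>S. \<phi> (h i))"
proof -
  interpret Vector_Spaces.linear scale_mat "(*)" \<phi> by fact
  show ?thesis by (rule sum)
qed

lemma linear_functional_diff:
  assumes "Vector_Spaces.linear scale_mat (*) \<phi>"
  shows "\<phi> (A - B) = \<phi> A - \<phi> B"
proof -
  interpret Vector_Spaces.linear scale_mat "(*)" \<phi> by fact
  show ?thesis by (rule diff)
qed

text \<open>
  The scalar part of Cauchy-Schwarz. The values \<open>s = 1\<close> and \<open>s = \<i>\<close> show that the form is Hermitian,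
  \<open>w = cnj z\<close>; the line \<open>s = - r cnj z\<close> with real \<open>r\<close> then gives a nonnegative real quadratic in \<open>r\<close>.
\<close>

lemma nonneg_form_discriminant:
  fixes a b z w :: complex
  assumes nonneg: "\<And>s. a + s * z + cnj s * w + s * cnj s * b \<in> \<real>\<^sub>\<ge>\<^sub>0"
    and b: "b \<in> \<real>\<^sub>\<ge>\<^sub>0"
  shows "(cmod z)\<^sup>2 \<le> Re a * Re b"
proof -
  have a: "a \<in> \<real>\<^sub>\<ge>\<^sub>0" using nonneg[of 0] by simp
  have ia: "Im a = 0" and ib: "Im b = 0" and rb: "0 \<le> Re b"
    using a b by (auto simp: complex_nonneg_Reals_iff)
  have "Im z + Im w = 0"
    using nonneg[of 1] ia ib by (simp add: complex_nonneg_Reals_iff)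
  moreover have "Re z - Re w = 0"
    using nonneg[of \<i>] ia ib by (simp add: complex_nonneg_Reals_iff)
  ultimately have w: "w = cnj z" by (simp add: complex_eq_iff)
  have quad: "0 \<le> Re a - 2 * r * (cmod z)\<^sup>2 + r\<^sup>2 * (cmod z)\<^sup>2 * Re b" for r :: real
  proof -
    have "a + (- of_real r * cnj z) * z + cnj (- of_real r * cnj z) * w
        + (- of_real r * cnj z) * cnj (- of_real r * cnj z) * b
      = a - of_real (2 * r) * (z * cnj z) + of_real (r\<^sup>2) * (z * cnj z) * b"
      by (simp add: w algebra_simps power2_eq_square)
    also have "\<dots> = a - of_real (2 * r * (cmod z)\<^sup>2) + of_real (r\<^sup>2 * (cmod z)\<^sup>2) * b"
      by (simp add: complex_norm_square[symmetric])
    finally have "a - of_real (2 * r * (cmod z)\<^sup>2) + of_real (r\<^sup>2 * (cmod z)\<^sup>2) * b \<in> \<real>\<^sub>\<ge>\<^sub>0"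
      using nonneg[of "- of_real r * cnj z"] by metis
    then have "0 \<le> Re (a - of_real (2 * r * (cmod z)\<^sup>2) + of_real (r\<^sup>2 * (cmod z)\<^sup>2) * b)"
      unfolding complex_nonneg_Reals_iff by blast
    then show ?thesis
      by (simp only: minus_complex.sel plus_complex.sel Re_complex_of_real
          times_complex.sel Im_complex_of_real mult_zero_left diff_zero)
  qed
  show ?thesis
  proof (cases "Re b = 0")
    case True
    \<comment> \<open>The quadratic has degenerated to an affine function that is bounded below, so its slope vanishes.\<close>
    have "(cmod z)\<^sup>2 = 0"
    proof (rule ccontr)
      assume nz: "(cmod z)\<^sup>2 \<noteq> 0"
      show False
        using quad[of "(Re a + 1) / (2 * (cmod z)\<^sup>2)"] nz True by simp
    qed
    then show ?thesis using True by simp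
  next
    case False
    with rb have "0 < Re b" by simp
    then show ?thesis
      \<comment> \<open>The minimum of the quadratic is attained at \<open>1 / Re b\<close>.\<close>
      using quad[of "1 / Re b"] by (simp add: field_simps power2_eq_square)
  qed
qed

text \<open>Positivity at \<open>A + s B\<close> for every scalar \<open>s\<close> is the hypothesis of the discriminant bound.\<close>

lemma Cauchy_Schwarz_functional:
  assumes lin: "Vector_Spaces.linear scale_mat (*) \<phi>"
    and pos: "\<And>A. \<phi> (adjoint_mat A ** A) \<in> \<real>\<^sub>\<ge>\<^sub>0"
  shows "(cmod (\<phi> (adjoint_mat A ** B)))\<^sup>2
    \<le> Re (\<phi> (adjoint_mat A ** A)) * Re (\<phi> (adjoint_mat B ** B))"
proof (rule nonneg_form_discriminant)
  fix s :: complex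
  have "adjoint_mat (A + scale_mat s B) ** (A + scale_mat s B)
    = adjoint_mat A ** A + scale_mat s (adjoint_mat A ** B)
      + scale_mat (cnj s) (adjoint_mat B ** A) + scale_mat (s * cnj s) (adjoint_mat B ** B)"
    by (simp add: adjoint_add adjoint_scale matrix_add_ldistrib mult_add_left
        scale_mat_mult_left scale_mat_mult_right) (simp add: scale_mat_def vec_eq_iff algebra_simps)
  then have "\<phi> (adjoint_mat (A + scale_mat s B) ** (A + scale_mat s B))
    = \<phi> (adjoint_mat A ** A) + s * \<phi> (adjoint_mat A ** B)
      + cnj s * \<phi> (adjoint_mat B ** A) + s * cnj s * \<phi> (adjoint_mat B ** B)"
    using lin by (simp add: linear_functional_iff)
  then show "\<phi> (adjoint_mat A ** A) + s * \<phi> (adjoint_mat A ** B)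
      + cnj s * \<phi> (adjoint_mat B ** A) + s * cnj s * \<phi> (adjoint_mat B ** B) \<in> \<real>\<^sub>\<ge>\<^sub>0"
    using pos by metis
qed (rule pos)

section \<open>Pure states and vector states\<close>

lemma cinner_square: "cinner ((adjoint_mat A ** A) *v x) x = of_real ((norm (A *v x))\<^sup>2)"
  by (simp add: matrix_vector_mul_assoc[symmetric] cinner_adjoint[of "adjoint_mat A"]
      cinner_self)

lemma vector_state:
  assumes "cinner x x = 1"
  shows "is_state (\<lambda>A. cinner (A *v x) x)"
  using assms
  by (simp add: is_state_def linear_functional_iff matrix_vector_mult_add_rdistrib
      cinner_add_left scale_mat_vec cinner_scale_left cinner_square)

text \<open>
  A state of value 1 on \<open>Q = x x\<^sup>*\<close> vanishes on \<open>P = 1 - Q\<close>, hence by Cauchy-Schwarz on every \<open>P B\<close>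
  and every \<open>B P\<close>. It therefore takes the same value at \<open>A\<close> and at \<open>Q A Q = \<langle>A x, x\<rangle> Q\<close>.
\<close>

lemma state_eq_vector_state:
  assumes a: "is_state \<psi>" and x: "cinner x x = 1" and one: "\<psi> (outer x x) = 1"
  shows "\<psi> A = cinner (A *v x) x"
proof -
  have lin: "Vector_Spaces.linear scale_mat (*) \<psi>"
    and pos: "\<And>A. \<psi> (adjoint_mat A ** A) \<in> \<real>\<^sub>\<ge>\<^sub>0" and unit: "\<psi> (mat 1) = 1"
    using a by (auto simp: is_state_def)
  define Q where "Q = outer x x"
  define P where "P = mat 1 - Q"
  have adj: "adjoint_mat P = P" and PP: "adjoint_mat P ** P = P"
    using complement_projection[OF x] by (simp_all only: P_def Q_def)
  have P0: "\<psi> P = 0"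
    using one unit by (simp add: P_def Q_def linear_functional_diff[OF lin])
  have l: "\<psi> (P ** B) = 0" for B
    using Cauchy_Schwarz_functional[OF lin pos, of P B] PP P0 adj by simp
  have r: "\<psi> (B ** P) = 0" for B
    using Cauchy_Schwarz_functional[OF lin pos, of "adjoint_mat B" P] PP P0 by simp
  have "\<psi> A = \<psi> (A ** Q)"
    using r[of A] by (simp add: P_def mult_diff_right linear_functional_diff[OF lin])
  also have "\<dots> = \<psi> (Q ** (A ** Q))"
    using l[of "A ** Q"] by (simp add: P_def mult_diff_left linear_functional_diff[OF lin])
  also have "Q ** (A ** Q) = scale_mat (cinner (A *v x) x) Q"
    by (simp add: Q_def mult_outer outer_vec outer_scale_left)
  finally show ?thesis
    using lin one by (simp add: linear_functional_iff Q_def)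
qed

text \<open>
  The vector state vanishes on the positive element \<open>1 - x x\<^sup>*\<close>, so the two states of a convex
  combination with positive weights vanish on it too; this determines both of them.
\<close>

lemma vector_state_pure:
  assumes x: "cinner x x = 1"
  shows "is_pure_state (\<lambda>A. cinner (A *v x) x)"
  unfolding is_pure_state_def extreme_point_of_def
proof (intro conjI ballI)
  let ?\<phi> = "\<lambda>A. cinner (A *v x) x"
  show "?\<phi> \<in> {\<psi>. is_state \<psi>}" using vector_state[OF x] by simp
  fix a b :: "complex ^ 'a ^ 'a \<Rightarrow> complex"
  assume "a \<in> {\<psi>. is_state \<psi>}" "b \<in> {\<psi>. is_state \<psi>}"
  then have a: "is_state a" and b: "is_state b" by auto
  show "?\<phi> \<notin> open_segment a b"
  proof
    assume "?\<phi> \<in> open_segment a b"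
    then obtain u where "a \<noteq> b" and u: "0 < u" "u < 1"
      and eq: "?\<phi> = (1 - u) *\<^sub>R a + u *\<^sub>R b"
      by (auto simp: in_segment)
    define Q where "Q = outer x x"
    define P where "P = mat 1 - Q"
    have PP: "adjoint_mat P ** P = P"
      using complement_projection(2)[OF x] by (simp only: P_def Q_def)
    have nn: "a P \<in> \<real>\<^sub>\<ge>\<^sub>0" "b P \<in> \<real>\<^sub>\<ge>\<^sub>0"
      using a b PP unfolding is_state_def by metis+
    have "?\<phi> P = 0"
      by (simp add: P_def Q_def matrix_vector_mult_diff_rdistrib outer_vec x)
        (simp add: cinner_def)
    then have "0 = (1 - u) *\<^sub>R a P + u *\<^sub>R b P"
      using fun_cong[OF eq, of P] by (simp add: scaleR_fun_def)
    then have "(1 - u) * Re (a P) + u * Re (b P) = 0"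
      by (simp add: complex_eq_iff)
    moreover have "0 \<le> (1 - u) * Re (a P)" "0 \<le> u * Re (b P)"
      using nn u by (auto simp: complex_nonneg_Reals_iff)
    ultimately have "(1 - u) * Re (a P) = 0" "u * Re (b P) = 0" by linarith+
    then have "a P = 0" "b P = 0"
      using nn u by (auto simp: complex_nonneg_Reals_iff complex_eq_iff)
    then have "a Q = 1" "b Q = 1"
      using a b by (auto simp: P_def is_state_def linear_functional_diff)
    then have "a A = b A" for A
      using state_eq_vector_state[OF a x] state_eq_vector_state[OF b x] by (simp add: Q_def)
    then show False using \<open>a \<noteq> b\<close> by auto
  qed
qed

text \<open>
  In terms of the density matrix \<open>D\<close> of \<open>\<phi>\<close> this is the rank-one bound \<open>(D e) (D e)\<^sup>* \<le> \<langle>D e, e\<rangle> D\<close>, valid for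
  every positive semidefinite matrix. Here \<open>v\<close> plays the role of \<open>D e\<close>, and the basis vector \<open>e\<close> is
  chosen so that \<open>\<langle>D e, e\<rangle>\<close> is nonzero, which is possible because \<open>D\<close> has trace 1.
\<close>

lemma state_dominates_vector_functional:
  fixes \<phi> :: "complex ^ 'm ^ 'm \<Rightarrow> complex"
  assumes st: "is_state \<phi>"
  obtains v :: "complex ^ 'm" and c :: real where "v \<noteq> 0" "0 < c"
    "\<And>A. (norm (A *v v))\<^sup>2 \<le> c * Re (\<phi> (adjoint_mat A ** A))"
proof -
  have lin: "Vector_Spaces.linear scale_mat (*) \<phi>"
    and pos: "\<And>A. \<phi> (adjoint_mat A ** A) \<in> \<real>\<^sub>\<ge>\<^sub>0" and unit: "\<phi> (mat 1) = 1"
    using st by (auto simp: is_state_def)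
  have "(\<Sum>p\<in>UNIV. \<phi> (outer (axis p 1) (axis p 1))) \<noteq> 0"
    using unit by (simp add: mat_one_expand linear_functional_sum[OF lin])
  then obtain p where p: "\<phi> (outer (axis p 1) (axis p 1)) \<noteq> 0"
    by (meson sum.neutral)
  define e :: "complex ^ 'm" where "e = axis p 1"
  have e1: "cinner e e = 1"
    by (simp add: cinner_self e_def norm_axis_1)
  define v :: "complex ^ 'm" where "v = (\<chi> q. \<phi> (outer e (axis q 1)))"
  have rep: "\<phi> (outer e y) = cinner v y" for y
    by (subst outer_expand)
      (use lin in \<open>simp add: linear_functional_sum[OF lin] linear_functional_iff cinner_def
        v_def mult.commute\<close>)
  have gram: "adjoint_mat (outer u e) ** outer u e = scale_mat (cinner u u) (outer e e)" for u
    by (simp add: adjoint_outer mult_outer outer_vec outer_scale_left)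
  define c where "c = Re (\<phi> (outer e e))"
  have "adjoint_mat (outer e e) ** outer e e = outer e e"
    by (simp add: adjoint_outer mult_outer outer_vec e1)
  then have "\<phi> (outer e e) \<in> \<real>\<^sub>\<ge>\<^sub>0" using pos by metis
  then have c: "\<phi> (outer e e) = of_real c" and "0 \<le> c"
    by (auto simp: c_def complex_nonneg_Reals_iff complex_eq_iff)
  with p have "0 < c" by (auto simp: e_def)
  have "v \<noteq> 0"
    using p rep[of e] by (auto simp: e_def cinner_def)
  have "(norm (A *v v))\<^sup>2 \<le> c * Re (\<phi> (adjoint_mat A ** A))" for A
  proof (cases "A *v v = 0")
    case True
    then show ?thesis
      using \<open>0 < c\<close> pos[of A] by (simp add: complex_nonneg_Reals_iff)
  next
    case False
    define u where "u = A *v v"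
    \<comment> \<open>For \<open>B = u e\<^sup>*\<close> the mixed term \<open>\<phi> (B\<^sup>* A)\<close> is \<open>\<parallel>u\<parallel>\<^sup>2\<close>, while \<open>\<phi> (B\<^sup>* B) = \<parallel>u\<parallel>\<^sup>2 c\<close>.\<close>
    have "\<phi> (adjoint_mat (outer u e) ** A) = cinner v (adjoint_mat A *v u)"
      by (simp add: adjoint_outer outer_mult rep)
    also have "\<dots> = of_real ((norm u)\<^sup>2)"
      by (simp add: cinner_adjoint[symmetric] u_def[symmetric] cinner_self)
    finally have "(norm u)\<^sup>2 * (norm u)\<^sup>2
        \<le> Re (\<phi> (scale_mat (cinner u u) (outer e e))) * Re (\<phi> (adjoint_mat A ** A))"
      using Cauchy_Schwarz_functional[OF lin pos, of "outer u e" A]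
      by (simp add: gram norm_mult power2_eq_square)
    also have "\<phi> (scale_mat (cinner u u) (outer e e)) = of_real ((norm u)\<^sup>2 * c)"
      using lin by (simp add: linear_functional_iff c cinner_self)
    finally have "(norm u)\<^sup>2 * (norm u)\<^sup>2 \<le> (norm u)\<^sup>2 * (c * Re (\<phi> (adjoint_mat A ** A)))"
      by (simp only: Re_complex_of_real mult.assoc)
    then show ?thesis
      unfolding u_def[symmetric] by (rule mult_left_le_imp_le) (use False in \<open>simp add: u_def\<close>)
  qed
  then show thesis using that \<open>v \<noteq> 0\<close> \<open>0 < c\<close> by blast
qed

text \<open>
  Subtracting from \<open>\<phi>\<close> a small multiple \<open>t \<psi>\<close> of the dominated vector state leaves a positive
  functional, which after normalisation is a state \<open>\<rho>\<close> with \<open>\<phi> = (1 - t) \<rho> + t \<psi>\<close>. Purity of \<open>\<phi>\<close> makes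
  the two summands equal.
\<close>

lemma pure_state_is_vector_state:
  fixes \<phi> :: "complex ^ 'm ^ 'm \<Rightarrow> complex"
  assumes pure: "is_pure_state \<phi>"
  obtains x where "\<And>A. \<phi> A = cinner (A *v x) x"
proof -
  have st: "is_state \<phi>"
    using pure by (auto simp: is_pure_state_def extreme_point_of_def)
  then have lin: "Vector_Spaces.linear scale_mat (*) \<phi>"
    and pos: "\<And>A. \<phi> (adjoint_mat A ** A) \<in> \<real>\<^sub>\<ge>\<^sub>0" and unit: "\<phi> (mat 1) = 1"
    by (auto simp: is_state_def)
  obtain v :: "complex ^ 'm" and c where "v \<noteq> 0" "0 < c"
    and dom: "\<And>A. (norm (A *v v))\<^sup>2 \<le> c * Re (\<phi> (adjoint_mat A ** A))"
    using state_dominates_vector_functional[OF st] by blast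
  define x where "x = of_real (1 / norm v) *s v"
  have x1: "cinner x x = 1"
    using \<open>v \<noteq> 0\<close>
    by (simp add: x_def cinner_scale_left cinner_scale_right)
      (simp add: cinner_self power2_eq_square)
  define \<psi> where "\<psi> = (\<lambda>A. cinner (A *v x) x)"
  have \<psi>: "is_state \<psi>"
    unfolding \<psi>_def by (rule vector_state[OF x1])
  \<comment> \<open>Domination alone allows \<open>(norm v)\<^sup>2 / c\<close>, which can be 1; halving it keeps \<open>1 - t\<close> positive.\<close>
  define t where "t = (norm v)\<^sup>2 / (2 * c)"
  have "0 < t" using \<open>v \<noteq> 0\<close> \<open>0 < c\<close> by (simp add: t_def)
  have "t < 1"
    using dom[of "mat 1"] \<open>0 < c\<close> unit by (simp add: t_def)
  have t\<psi>: "t * Re (\<psi> (adjoint_mat A ** A)) \<le> Re (\<phi> (adjoint_mat A ** A))" for A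
  proof -
    have "A *v x = of_real (1 / norm v) *s (A *v v)"
      by (simp add: x_def vector_scalar_commute)
    then have "cinner (A *v x) (A *v x) = of_real ((norm (A *v v))\<^sup>2 / (norm v)\<^sup>2)"
      by (simp add: cinner_scale_left cinner_scale_right)
        (simp add: cinner_self power2_eq_square)
    then have "\<psi> (adjoint_mat A ** A) = of_real ((norm (A *v v))\<^sup>2 / (norm v)\<^sup>2)"
      by (simp only: \<psi>_def cinner_square cinner_self)
    then have "t * Re (\<psi> (adjoint_mat A ** A)) = (norm (A *v v))\<^sup>2 / (2 * c)"
      using \<open>v \<noteq> 0\<close> by (simp add: t_def)
    also have "\<dots> \<le> Re (\<phi> (adjoint_mat A ** A)) / 2"
      using dom[of A] \<open>0 < c\<close> by (simp add: field_simps)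
    also have "\<dots> \<le> Re (\<phi> (adjoint_mat A ** A))"
      using pos[of A] by (simp add: complex_nonneg_Reals_iff)
    finally show ?thesis .
  qed
  define \<rho> where "\<rho> = (\<lambda>A. (\<phi> A - of_real t * \<psi> A) / of_real (1 - t))"
  have "is_state \<rho>"
    unfolding is_state_def
  proof (intro conjI allI)
    show "Vector_Spaces.linear scale_mat (*) \<rho>"
      using lin \<psi> \<open>t < 1\<close>
      by (simp add: is_state_def linear_functional_iff \<rho>_def add_divide_distrib
          diff_divide_distrib right_diff_distrib distrib_left del: of_real_diff)
    show "\<rho> (mat 1) = 1"
      using unit \<psi> \<open>t < 1\<close> by (simp add: \<rho>_def is_state_def)
    fix A
    have "\<psi> (adjoint_mat A ** A) \<in> \<real>\<^sub>\<ge>\<^sub>0"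
      using \<psi> by (auto simp: is_state_def)
    then show "\<rho> (adjoint_mat A ** A) \<in> \<real>\<^sub>\<ge>\<^sub>0"
      using t\<psi>[of A] pos[of A] \<open>t < 1\<close>
      by (simp only: \<rho>_def complex_nonneg_Reals_iff Re_divide_of_real Im_divide_of_real) simp
  qed
  moreover have "\<phi> = (1 - t) *\<^sub>R \<rho> + t *\<^sub>R \<psi>"
    using \<open>t < 1\<close>
    by (simp add: fun_eq_iff scaleR_fun_def \<rho>_def scaleR_conv_of_real del: of_real_diff)
  moreover have "\<phi> \<notin> open_segment \<rho> \<psi>"
    using pure \<psi> \<open>is_state \<rho>\<close> by (auto simp: is_pure_state_def extreme_point_of_def)
  ultimately have "\<rho> = \<psi>"
    using \<open>0 < t\<close> \<open>t < 1\<close> by (auto simp: in_segment)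
  with \<open>\<phi> = (1 - t) *\<^sub>R \<rho> + t *\<^sub>R \<psi>\<close> have "\<phi> = \<psi>"
    by (simp add: scaleR_add_left[symmetric])
  then show thesis using that[of x] by (simp add: \<psi>_def)
qed

section \<open>The tracial marginal\<close>

text \<open>
  Orthonormality says that the matrix \<open>G\<close> with rows \<open>g i\<close> satisfies \<open>G G\<^sup>* = 1\<close>. A one-sided inverse of
  a square matrix is two-sided, so \<open>y = (y G\<^sup>*) G\<close> expands every \<open>y\<close> in the rows.
\<close>

lemma orthonormal_basisI:
  fixes g :: "'n::finite \<Rightarrow> complex ^ 'n"
  assumes ortho: "\<And>i j. cinner (g i) (g j) = (if i = j then 1 else 0)"
  shows "orthonormal_basis g"
proof -
  define G where "G = (\<chi> i j. g i $ j)"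
  have "G ** adjoint_mat G = mat 1"
    using ortho by (simp add: vec_eq_iff G_def adjoint_mat_def transpose_def
        matrix_matrix_mult_def mat_def cinner_def)
  then have inv: "adjoint_mat G ** G = mat 1"
    by (rule iffD1[OF matrix_left_right_inverse])
  have "y \<in> vec.span (range g)" for y
  proof -
    have "y = y v* (adjoint_mat G ** G)" by (simp add: inv)
    also have "\<dots> = (y v* adjoint_mat G) v* G" by (simp add: vector_matrix_mul_assoc)
    also have "\<dots> = (\<Sum>i\<in>UNIV. (y v* adjoint_mat G) $ i *s g i)"
      by (simp add: vec_eq_iff vector_matrix_mult_def G_def mult.commute)
    also have "\<dots> \<in> vec.span (range g)"
      by (intro vec.span_sum vec.span_scale vec.span_base) auto
    finally show ?thesis .
  qed
  with ortho show ?thesis by (auto simp: orthonormal_basis_def)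
qed

lemma left_marginal_matrix_unit:
  fixes x :: "complex ^ ('n::finite \<times> 'n)"
  shows "cinner (tensor_mat (outer (axis j 1) (axis i 1)) (mat 1) *v x) x
    = (\<Sum>k\<in>UNIV. x $ (i, k) * cnj (x $ (j, k)))"
proof -
  have iterate: "sum h UNIV = (\<Sum>a\<in>UNIV. \<Sum>b\<in>UNIV. h (a, b))"
    for h :: "'n \<times> 'n \<Rightarrow> complex"
    by (simp add: sum.cartesian_product)
  have "(tensor_mat (outer (axis j 1) (axis i 1)) (mat 1) *v x) $ (a, b)
      = (if a = j then x $ (i, b) else 0)" for a b
  proof -
    have "(tensor_mat (outer (axis j 1) (axis i 1)) (mat 1) *v x) $ (a, b)
      = (\<Sum>q\<in>UNIV. if q = (i, b) then (if a = j then x $ (i, b) else 0) else 0)"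
      unfolding matrix_vector_mult_def
      by (auto simp: tensor_mat_def outer_def axis_def mat_def prod_eq_iff intro!: sum.cong)
    then show ?thesis by simp
  qed
  then have "cinner (tensor_mat (outer (axis j 1) (axis i 1)) (mat 1) *v x) x
    = (\<Sum>a\<in>UNIV. \<Sum>b\<in>UNIV. (if a = j then x $ (i, b) else 0) * cnj (x $ (a, b)))"
    by (simp add: cinner_def iterate)
  also have "\<dots> = (\<Sum>a\<in>UNIV. if a = j then \<Sum>b\<in>UNIV. x $ (i, b) * cnj (x $ (j, b)) else 0)"
    by (intro sum.cong) auto
  finally show ?thesis by simp
qed

text \<open>
  Collecting the coefficients of \<open>x\<close> by their first index writes it as
  \<open>\<Sum>i. e\<^sub>i \<otimes> x\<^sub>i\<close>, where \<open>x\<^sub>i\<close> is a row of the coefficient matrix. The trace identity at matrix units says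
  that the rows are orthogonal of squared length \<open>1/n\<close>, so scaling them by \<open>\<surd>n\<close> gives the second basis.
\<close>

lemma tracial_vector_maximally_entangled:
  fixes x :: "complex ^ ('n::finite \<times> 'n)"
  assumes tr: "\<And>y. cinner (tensor_mat y (mat 1) *v x) x = normalized_trace y"
  obtains f g :: "'n \<Rightarrow> complex ^ 'n" where "orthonormal_basis f" "orthonormal_basis g"
    "x = (\<Sum>i\<in>UNIV. (1 / complex_of_real (sqrt (real CARD('n)))) *s tensor_vec (f i) (g i))"
proof -
  define r where "r = complex_of_real (sqrt (real CARD('n)))"
  have r: "r \<noteq> 0" "cnj r = r" "r * r = of_nat CARD('n)"
    by (simp_all add: r_def of_real_mult[symmetric] del: of_real_mult)
  define f :: "'n \<Rightarrow> complex ^ 'n" where "f = (\<lambda>i. axis i 1)"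
  define g :: "'n \<Rightarrow> complex ^ 'n" where "g = (\<lambda>i. \<chi> k. r * x $ (i, k))"
  have "orthonormal_basis f"
    by (rule orthonormal_basisI)
      (auto simp: f_def cinner_def axis_def if_distrib[of "\<lambda>z. _ * z"] if_distrib[of cnj]
        cong: if_cong)
  moreover have "orthonormal_basis g"
  proof (rule orthonormal_basisI)
    fix i j
    have "cinner (g i) (g j) = r * r * (\<Sum>k\<in>UNIV. x $ (i, k) * cnj (x $ (j, k)))"
      by (simp add: cinner_def g_def r(2) sum_distrib_left mult_ac)
    also have "\<dots> = r * r * normalized_trace (outer (axis j 1) (axis i 1))"
      by (simp add: left_marginal_matrix_unit[symmetric] tr)
    also have "\<dots> = trace (outer (axis j 1) (axis i 1 :: complex ^ 'n))"
      by (simp add: normalized_trace_def r(3))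
    also have "\<dots> = (if i = j then 1 else 0)"
      by (auto simp: trace_def outer_def axis_def if_distrib[of "\<lambda>z. _ * z"] if_distrib[of cnj]
        cong: if_cong)
    finally show "cinner (g i) (g j) = (if i = j then 1 else 0)" .
  qed
  moreover have "x = (\<Sum>i\<in>UNIV. (1 / r) *s tensor_vec (f i) (g i))"
    using r(1) by (auto simp: vec_eq_iff tensor_vec_def f_def g_def axis_def
        if_distrib[of "\<lambda>z. z * _"] if_distrib[of "\<lambda>z. z / _"] cong: if_cong)
  ultimately show thesis using that unfolding r_def by blast
qed

theorem theorem1p1:
  fixes \<phi> :: "complex ^ ('n::finite \<times> 'n) ^ ('n \<times> 'n) \<Rightarrow> complex"
  assumes "CARD('n) \<ge> 2"
    and "marginal_tracial_state \<phi>"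
  shows "is_pure_state \<phi> \<longleftrightarrow>
    (\<exists>f g :: 'n \<Rightarrow> complex ^ 'n. orthonormal_basis f \<and> orthonormal_basis g \<and>
      (let \<xi> = (\<Sum>i\<in>UNIV. (1 / complex_of_real (sqrt (real CARD('n)))) *s tensor_vec (f i) (g i))
       in \<forall>A. \<phi> A = cinner (A *v \<xi>) \<xi>))"
    (is "_ \<longleftrightarrow> ?R")
proof
  assume "is_pure_state \<phi>"
  then obtain x where x: "\<And>A. \<phi> A = cinner (A *v x) x"
    using pure_state_is_vector_state by blast
  then have "cinner (tensor_mat y (mat 1) *v x) x = normalized_trace y" for y
    using assms(2) by (metis marginal_tracial_state_def)
  then show ?R
    using x by (elim tracial_vector_maximally_entangled) (auto simp: Let_def)
next
  assume ?R
  then obtain x where x: "\<And>A. \<phi> A = cinner (A *v x) x"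
    by (auto simp: Let_def)
  have "\<phi> (mat 1) = 1"
    using assms(2) by (simp add: marginal_tracial_state_def is_state_def)
  then have "cinner x x = 1" by (simp add: x)
  moreover have "\<phi> = (\<lambda>A. cinner (A *v x) x)" by (simp add: x fun_eq_iff)
  ultimately show "is_pure_state \<phi>" using vector_state_pure by metis
qed

end
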